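(* Let $L$ be an Eulerian poset of length $d+1$ and let $t$ be an integer with $0\le t\le d-1$. Then $E_t(L)$ is an Eulerian poset of the same length $d+1$.
   Context: All posets are finite. A bounded poset has a unique minimal element $\hat 0$ and a unique maximal element $\hat 1$. A bounded poset is graded if all its maximal chains have the same length; its rank function $r$ is normalized by $r(\hat 0)=0$, and its length is $r(\hat 1)$. For a graded poset $L$ of length $d+1$, $L_i$ denotes the set of elements of rank $i+1$. A graded poset is Eulerian if every interval $[x,y]$ with $x<y$ has the same number of elements of odd rank and of even rank. For a graded poset $L$ of length $d+1$ and an integer $0\le t\le d-1$, the poset $E_t(L)$ consists of the following subsets of $L$, ordered by reversed inclusion: the empty set; the one-element sets $\{y\}$ for $y\in L_t$; and the intervals $[x,z]\subseteq L$ such that some $y\in L_t$ satisfies $x<y<z$. *)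

theory Defs
  imports "HOL-Algebra.Order"
begin

section \<open>Finite bounded posets\<close>

definition finite_poset :: "'a gorder \<Rightarrow> bool" where
  "finite_poset L \<longleftrightarrow> partial_order L \<and> finite (carrier L)"

definition minimal_element :: "'a gorder \<Rightarrow> 'a \<Rightarrow> bool" where
  "minimal_element L x \<longleftrightarrow> x \<in> carrier L \<and> \<not> (\<exists>y\<in>carrier L. y \<sqsubset>\<^bsub>L\<^esub> x)"

definition maximal_element :: "'a gorder \<Rightarrow> 'a \<Rightarrow> bool" where
  "maximal_element L x \<longleftrightarrow> x \<in> carrier L \<and> \<not> (\<exists>y\<in>carrier L. x \<sqsubset>\<^bsub>L\<^esub> y)"

definition bounded_poset :: "'a gorder \<Rightarrow> bool" where
  "bounded_poset L \<longleftrightarrow>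
     finite_poset L \<and> (\<exists>!x. minimal_element L x) \<and> (\<exists>!x. maximal_element L x)"

definition zero_hat :: "'a gorder \<Rightarrow> 'a" where
  "zero_hat L = (THE x. minimal_element L x)"

definition one_hat :: "'a gorder \<Rightarrow> 'a" where
  "one_hat L = (THE x. maximal_element L x)"

section \<open>Graded posets, rank and length\<close>

text \<open>The length of a chain is its number of elements minus one. (The empty chain is never
  maximal in a bounded poset.)\<close>

definition chain_length :: "'a set \<Rightarrow> nat" where
  "chain_length C = card C - 1"

definition graded_poset :: "'a gorder \<Rightarrow> bool" where
  "graded_poset L \<longleftrightarrow> bounded_poset L \<and>
     (\<forall>C D. pred_on.maxchain (carrier L) (lless L) C \<longrightarrow>
            pred_on.maxchain (carrier L) (lless L) D \<longrightarrow> chain_length C = chain_length D)"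

text \<open>The rank of \<open>x\<close> is the length of a longest chain from \<open>zero_hat L\<close> to \<open>x\<close>. For a graded
  poset this is the rank function normalized by \<open>zero_hat L \<mapsto> 0\<close>: see
  \<open>poset_rank_zero_hat\<close> and \<open>poset_rank_cover\<close> below, which determine it.\<close>

definition poset_rank :: "'a gorder \<Rightarrow> 'a \<Rightarrow> nat" where
  "poset_rank L x = Max (chain_length ` {C. pred_on.chain \<lbrace>zero_hat L..x\<rbrace>\<^bsub>L\<^esub> (lless L) C})"

definition poset_length :: "'a gorder \<Rightarrow> nat" where
  "poset_length L = poset_rank L (one_hat L)"

text \<open>Note the shift by one: \<open>level L i\<close> consists of the elements of rank \<open>i + 1\<close>.\<close>

definition level :: "'a gorder \<Rightarrow> nat \<Rightarrow> 'a set" where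
  "level L i = {x \<in> carrier L. poset_rank L x = i + 1}"

section \<open>Eulerian posets and the posets \<open>E\<^sub>t(L)\<close>\<close>

definition eulerian_poset :: "'a gorder \<Rightarrow> bool" where
  "eulerian_poset L \<longleftrightarrow> graded_poset L \<and>
     (\<forall>x\<in>carrier L. \<forall>y\<in>carrier L. x \<sqsubset>\<^bsub>L\<^esub> y \<longrightarrow>
        card {z \<in> \<lbrace>x..y\<rbrace>\<^bsub>L\<^esub>. odd (poset_rank L z)} = card {z \<in> \<lbrace>x..y\<rbrace>\<^bsub>L\<^esub>. even (poset_rank L z)})"

definition E_poset :: "nat \<Rightarrow> 'a gorder \<Rightarrow> 'a set gorder" where
  "E_poset t L =
     \<lparr> carrier = {{}} \<union> {{y} | y. y \<in> level L t}
         \<union> {\<lbrace>x..z\<rbrace>\<^bsub>L\<^esub> | x z. x \<in> carrier L \<and> z \<in> carrier L \<and>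
              (\<exists>y\<in>level L t. x \<sqsubset>\<^bsub>L\<^esub> y \<and> y \<sqsubset>\<^bsub>L\<^esub> z)},
       eq = (=),
       le = (\<lambda>A B. B \<subseteq> A) \<rparr>"

section \<open>The normalized rank function\<close>

lemma lless_iff:
  assumes "finite_poset L"
  shows "x \<sqsubset>\<^bsub>L\<^esub> y \<longleftrightarrow> x \<sqsubseteq>\<^bsub>L\<^esub> y \<and> x \<noteq> y"
proof -
  interpret partial_order L using assms by (simp add: finite_poset_def)
  show ?thesis by (simp add: lless_def eq_is_equal)
qed

lemma zero_hat_minimal:
  assumes "bounded_poset L"
  shows "minimal_element L (zero_hat L)"
  using assms unfolding bounded_poset_def zero_hat_def by (metis (no_types, lifting) theI')

lemma zero_hat_closed: "bounded_poset L \<Longrightarrow> zero_hat L \<in> carrier L"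
  using zero_hat_minimal by (auto simp: minimal_element_def)

lemma zero_hat_le:
  assumes L: "bounded_poset L" and t: "t \<in> carrier L"
  shows "zero_hat L \<sqsubseteq>\<^bsub>L\<^esub> t"
proof -
  have fp: "finite_poset L" using L by (simp add: bounded_poset_def)
  interpret partial_order L using fp by (simp add: finite_poset_def)
  have fin: "finite (carrier L)" using fp by (simp add: finite_poset_def)
  define S where "S = {s \<in> carrier L. s \<sqsubseteq>\<^bsub>L\<^esub> t}"
  define dn where "dn s = {u \<in> carrier L. u \<sqsubseteq>\<^bsub>L\<^esub> s}" for s
  have "t \<in> S" using t by (simp add: S_def)
  then obtain s where s: "s \<in> S" and min: "\<And>u. u \<in> S \<Longrightarrow> card (dn s) \<le> card (dn u)"
    using arg_min_nat_lemma[of "\<lambda>s. s \<in> S" t "\<lambda>s. card (dn s)"] by blast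
  have sc: "s \<in> carrier L" "s \<sqsubseteq>\<^bsub>L\<^esub> t" using s by (auto simp: S_def)
  have "minimal_element L s"
    unfolding minimal_element_def
  proof (intro conjI notI)
    assume "\<exists>y\<in>carrier L. y \<sqsubset>\<^bsub>L\<^esub> s"
    then obtain y where y: "y \<in> carrier L" "y \<sqsubseteq>\<^bsub>L\<^esub> s" "y \<noteq> s"
      using lless_iff[OF fp] by blast
    have "y \<in> S" using y sc t le_trans unfolding S_def by blast
    moreover have "dn y \<subset> dn s"
    proof -
      have "dn y \<subseteq> dn s" using y sc le_trans unfolding dn_def by blast
      moreover have "s \<in> dn s" "s \<notin> dn y" using y sc le_antisym unfolding dn_def by auto
      ultimately show ?thesis by blast
    qed
    moreover have "finite (dn s)" using fin by (simp add: dn_def)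
    ultimately show False using min psubset_card_mono by (metis leD)
  qed (use sc in auto)
  then have "s = zero_hat L"
    using zero_hat_minimal[OF L] L unfolding bounded_poset_def by blast
  then show ?thesis using sc by simp
qed

lemma poset_rank_zero_hat:
  assumes L: "bounded_poset L"
  shows "poset_rank L (zero_hat L) = 0"
proof -
  have fp: "finite_poset L" using L by (simp add: bounded_poset_def)
  interpret partial_order L using fp by (simp add: finite_poset_def)
  have "\<lbrace>zero_hat L..zero_hat L\<rbrace>\<^bsub>L\<^esub> \<subseteq> {zero_hat L}"
    using zero_hat_closed[OF L] le_antisym by (auto simp: at_least_at_most_def)
  then have "C \<subseteq> {zero_hat L}" if "pred_on.chain \<lbrace>zero_hat L..zero_hat L\<rbrace>\<^bsub>L\<^esub> (lless L) C" for C
    using that by (auto simp: pred_on.chain_def)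
  then have "chain_length C = 0" if "pred_on.chain \<lbrace>zero_hat L..zero_hat L\<rbrace>\<^bsub>L\<^esub> (lless L) C" for C
    using that by (fastforce simp: chain_length_def subset_singleton_iff)
  then have "chain_length ` {C. pred_on.chain \<lbrace>zero_hat L..zero_hat L\<rbrace>\<^bsub>L\<^esub> (lless L) C} = {0}"
    using pred_on.chain_empty by (auto simp: image_iff; metis)
  then show ?thesis by (simp add: poset_rank_def)
qed

lemma chain_iff:
  assumes "finite_poset L"
  shows "pred_on.chain A (lless L) C \<longleftrightarrow>
    C \<subseteq> A \<and> (\<forall>u\<in>C. \<forall>v\<in>C. u = v \<or> u \<sqsubseteq>\<^bsub>L\<^esub> v \<or> v \<sqsubseteq>\<^bsub>L\<^esub> u)"
  unfolding pred_on.chain_def using lless_iff[OF assms] by auto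

lemma longest_chain:
  assumes L: "bounded_poset L" and x: "x \<in> carrier L"
  obtains C where "pred_on.chain \<lbrace>zero_hat L..x\<rbrace>\<^bsub>L\<^esub> (lless L) C" "x \<in> C"
    "card C = Suc (poset_rank L x)"
    "\<And>D. pred_on.chain \<lbrace>zero_hat L..x\<rbrace>\<^bsub>L\<^esub> (lless L) D \<Longrightarrow> C \<subseteq> D \<Longrightarrow> D = C"
proof -
  have fp: "finite_poset L" using L by (simp add: bounded_poset_def)
  interpret partial_order L using fp by (simp add: finite_poset_def)
  let ?I = "\<lbrace>zero_hat L..x\<rbrace>\<^bsub>L\<^esub>"
  have finI: "finite ?I" using fp by (simp add: finite_poset_def at_least_at_most_def)
  define S where "S = {C. pred_on.chain ?I (lless L) C}"
  have sub: "C \<subseteq> ?I" if "C \<in> S" for C using that by (simp add: S_def pred_on.chain_def)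
  have "S \<subseteq> Pow ?I" using sub by blast
  then have finS: "finite S" using finI finite_subset by blast
  have xI: "x \<in> ?I" using x zero_hat_le[OF L x] by (simp add: at_least_at_most_def)
  have "{} \<in> S" by (simp add: S_def pred_on.chain_empty)
  then have "poset_rank L x \<in> chain_length ` S"
    unfolding poset_rank_def S_def[symmetric] using finS by (intro Max_in) auto
  then obtain C0 where C0: "C0 \<in> S" "chain_length C0 = poset_rank L x" by auto
  have mx: "chain_length D \<le> poset_rank L x" if "D \<in> S" for D
    unfolding poset_rank_def S_def[symmetric] using finS that by simp
  have ins: "insert x D \<in> S" if "D \<in> S" for D
    using that xI unfolding S_def chain_iff[OF fp] by (auto simp: at_least_at_most_def)
  define C where "C = insert x C0"
  have CS: "C \<in> S" using ins C0 by (simp add: C_def)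
  have finC: "finite D" if "D \<in> S" for D using sub[OF that] finI finite_subset by blast
  have cc: "card D = Suc (chain_length D)" if "D \<in> S" "x \<in> D" for D
    using finC[OF that(1)] that card_gt_0_iff[of D] by (auto simp: chain_length_def)
  have "chain_length C0 \<le> chain_length C"
    using card_insert_le[of C0 x] by (simp add: chain_length_def C_def)
  then have "chain_length C = poset_rank L x" using mx[OF CS] C0 by simp
  then have cardC: "card C = Suc (poset_rank L x)" using cc[OF CS] by (simp add: C_def)
  show thesis
  proof (rule that)
    show "pred_on.chain ?I (lless L) C" using CS by (simp add: S_def)
    show "x \<in> C" by (simp add: C_def)
    show "card C = Suc (poset_rank L x)" by (rule cardC)
    fix D assume D: "pred_on.chain ?I (lless L) D" "C \<subseteq> D"
    then have DS: "D \<in> S" by (simp add: S_def)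
    have "card D \<le> card C" using cc[OF DS] mx[OF DS] cardC D by (auto simp: C_def)
    then show "D = C" using D finC[OF DS] card_seteq by metis
  qed
qed

lemma maximal_upper_chain:
  assumes fp: "finite_poset L" and y: "y \<in> carrier L"
  obtains K where "pred_on.maxchain {u \<in> carrier L. y \<sqsubseteq>\<^bsub>L\<^esub> u} (lless L) K" "y \<in> K"
proof -
  interpret partial_order L using fp by (simp add: finite_poset_def)
  let ?U = "{u \<in> carrier L. y \<sqsubseteq>\<^bsub>L\<^esub> u}"
  obtain K where K: "pred_on.maxchain ?U (lless L) K" using pred_on.Hausdorff by blast
  have "pred_on.chain ?U (lless L) (insert y K)"
    using K y unfolding pred_on.maxchain_def chain_iff[OF fp] by auto
  then have "y \<in> K" using K unfolding pred_on.maxchain_def by blast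
  with K show thesis using that by blast
qed

lemma poset_rank_cover:
  assumes L: "graded_poset L" and x: "x \<in> carrier L" and y: "y \<in> carrier L"
    and xy: "x \<sqsubset>\<^bsub>L\<^esub> y" and cov: "\<not> (\<exists>z\<in>carrier L. x \<sqsubset>\<^bsub>L\<^esub> z \<and> z \<sqsubset>\<^bsub>L\<^esub> y)"
  shows "poset_rank L y = Suc (poset_rank L x)"
proof -
  have bp: "bounded_poset L" using L by (simp add: graded_poset_def)
  have fp: "finite_poset L" using bp by (simp add: bounded_poset_def)
  interpret partial_order L using fp by (simp add: finite_poset_def)
  have fin: "finite (carrier L)" using fp by (simp add: finite_poset_def)
  note ch = chain_iff[OF fp] and ll = lless_iff[OF fp]
  let ?U = "{u \<in> carrier L. y \<sqsubseteq>\<^bsub>L\<^esub> u}"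
  obtain C where C: "pred_on.chain \<lbrace>zero_hat L..x\<rbrace>\<^bsub>L\<^esub> (lless L) C" "x \<in> C"
    "card C = Suc (poset_rank L x)"
    and Cm: "\<And>D. pred_on.chain \<lbrace>zero_hat L..x\<rbrace>\<^bsub>L\<^esub> (lless L) D \<Longrightarrow> C \<subseteq> D \<Longrightarrow> D = C"
    using longest_chain[OF bp x] by metis
  obtain D where D: "pred_on.chain \<lbrace>zero_hat L..y\<rbrace>\<^bsub>L\<^esub> (lless L) D" "y \<in> D"
    "card D = Suc (poset_rank L y)"
    and Dm: "\<And>T. pred_on.chain \<lbrace>zero_hat L..y\<rbrace>\<^bsub>L\<^esub> (lless L) T \<Longrightarrow> D \<subseteq> T \<Longrightarrow> T = D"
    using longest_chain[OF bp y] by metis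
  obtain K where K: "pred_on.maxchain ?U (lless L) K" "y \<in> K"
    using maximal_upper_chain[OF fp y] by blast
  have Kc: "pred_on.chain ?U (lless L) K" using K by (simp add: pred_on.maxchain_def)
  have Km: "T = K" if "pred_on.chain ?U (lless L) T" "K \<subseteq> T" for T
    using K(1) that unfolding pred_on.maxchain_def by blast
  have Cx: "u \<in> carrier L" "u \<sqsubseteq>\<^bsub>L\<^esub> x" if "u \<in> C" for u
    using C(1) that unfolding ch by (auto simp: at_least_at_most_def)
  have Dy: "u \<in> carrier L" "u \<sqsubseteq>\<^bsub>L\<^esub> y" if "u \<in> D" for u
    using D(1) that unfolding ch by (auto simp: at_least_at_most_def)
  have Ky: "u \<in> carrier L" "y \<sqsubseteq>\<^bsub>L\<^esub> u" if "u \<in> K" for u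
    using Kc that unfolding ch by auto
  have xly: "x \<sqsubseteq>\<^bsub>L\<^esub> y" "x \<noteq> y" using xy ll by auto
  have Cy: "u \<sqsubseteq>\<^bsub>L\<^esub> y" if "u \<in> C" for u using Cx[OF that] xly x y le_trans by blast
  have low: "pred_on.chain \<lbrace>zero_hat L..v\<rbrace>\<^bsub>L\<^esub> (lless L) {u \<in> T. u \<sqsubseteq>\<^bsub>L\<^esub> v}"
    if "pred_on.chain (carrier L) (lless L) T" for T v
    using that zero_hat_le[OF bp] unfolding ch by (auto simp: at_least_at_most_def)
  have up: "pred_on.chain ?U (lless L) {u \<in> T. y \<sqsubseteq>\<^bsub>L\<^esub> u}"
    if "pred_on.chain (carrier L) (lless L) T" for T
    using that unfolding ch by auto
  have mCK: "pred_on.maxchain (carrier L) (lless L) (C \<union> K)"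
    unfolding pred_on.maxchain_def
  proof (intro conjI notI)
    have "u \<sqsubseteq>\<^bsub>L\<^esub> v" if "u \<in> C" "v \<in> K" for u v
      using Cx(1)[OF that(1)] Cy[OF that(1)] Ky[OF that(2)] y le_trans by blast
    then show "pred_on.chain (carrier L) (lless L) (C \<union> K)"
      using C(1) Kc Cx Ky unfolding ch by blast
    assume "\<exists>T. pred_on.chain (carrier L) (lless L) T \<and> C \<union> K \<subset> T"
    then obtain T where T: "pred_on.chain (carrier L) (lless L) T" "C \<union> K \<subset> T" by blast
    have "{u \<in> T. u \<sqsubseteq>\<^bsub>L\<^esub> x} = C" using Cm[OF low[OF T(1)]] T(2) Cx by blast
    moreover have "{u \<in> T. y \<sqsubseteq>\<^bsub>L\<^esub> u} = K" using Km[OF up[OF T(1)]] T(2) Ky by blast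
    moreover have "u \<sqsubseteq>\<^bsub>L\<^esub> x \<or> y \<sqsubseteq>\<^bsub>L\<^esub> u" if u: "u \<in> T" for u
    proof -
      have uc: "u \<in> carrier L" and "x \<in> T" "y \<in> T" using T u C(2) K(2) unfolding ch by auto
      then have "u = x \<or> u \<sqsubseteq>\<^bsub>L\<^esub> x \<or> x \<sqsubseteq>\<^bsub>L\<^esub> u" "u = y \<or> u \<sqsubseteq>\<^bsub>L\<^esub> y \<or> y \<sqsubseteq>\<^bsub>L\<^esub> u"
        using T(1) u unfolding ch by blast+
      then show ?thesis using cov uc ll x y le_refl by metis
    qed
    ultimately show False using T(2) by blast
  qed
  have mDK: "pred_on.maxchain (carrier L) (lless L) (D \<union> K)"
    unfolding pred_on.maxchain_def
  proof (intro conjI notI)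
    have "u \<sqsubseteq>\<^bsub>L\<^esub> v" if "u \<in> D" "v \<in> K" for u v
      using Dy[OF that(1)] Ky[OF that(2)] y le_trans by blast
    then show "pred_on.chain (carrier L) (lless L) (D \<union> K)"
      using D(1) Kc Dy Ky unfolding ch by blast
    assume "\<exists>T. pred_on.chain (carrier L) (lless L) T \<and> D \<union> K \<subset> T"
    then obtain T where T: "pred_on.chain (carrier L) (lless L) T" "D \<union> K \<subset> T" by blast
    have "{u \<in> T. u \<sqsubseteq>\<^bsub>L\<^esub> y} = D" using Dm[OF low[OF T(1)]] T(2) Dy by blast
    moreover have "{u \<in> T. y \<sqsubseteq>\<^bsub>L\<^esub> u} = K" using Km[OF up[OF T(1)]] T(2) Ky by blast
    moreover have "u \<sqsubseteq>\<^bsub>L\<^esub> y \<or> y \<sqsubseteq>\<^bsub>L\<^esub> u" if u: "u \<in> T" for u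
    proof -
      have "y \<in> T" using T K(2) by blast
      then have "u = y \<or> u \<sqsubseteq>\<^bsub>L\<^esub> y \<or> y \<sqsubseteq>\<^bsub>L\<^esub> u" using T(1) u unfolding ch by blast
      then show ?thesis using y le_refl by blast
    qed
    ultimately show False using T(2) by blast
  qed
  have fins: "finite C" "finite D" "finite K"
    using Cx Dy Ky fin by (meson finite_subset subsetI)+
  have "C \<inter> K = {}"
  proof -
    have False if "u \<in> C" "u \<in> K" for u
    proof -
      have "u = y" using Cx(1)[OF that(1)] Cy[OF that(1)] Ky(2)[OF that(2)] y le_antisym by blast
      then show False using Cx(2)[OF that(1)] xly x y le_antisym by blast
    qed
    then show ?thesis by blast
  qed
  then have c1: "card (C \<union> K) = card C + card K" using fins by (simp add: card_Un_disjoint)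
  have "D \<inter> K = {y}" using D(2) K(2) Dy Ky y le_antisym by blast
  then have c2: "card (D \<union> K) + 1 = card D + card K"
    using card_Un_Int[OF fins(2,3)] by simp
  have "chain_length (C \<union> K) = chain_length (D \<union> K)"
    using L mCK mDK unfolding graded_poset_def by blast
  moreover have "card K > 0" using fins K(2) card_gt_0_iff by blast
  ultimately show ?thesis using c1 c2 C(3) D(3) by (simp add: chain_length_def)
qed

end

theory Submission
  imports Defs
begin

text \<open>Write \<open>r\<close> for the rank in \<open>L\<close>, \<open>n\<close> for the length of \<open>L\<close>, and call a nonempty interval \<open>[u, v]\<close> crossing if
  its ends satisfy \<open>r u < t + 1 < r v\<close>. In a graded poset these are exactly the intervals that contain
  an element of rank \<open>t + 1\<close> strictly between their ends, so they form the third kind of elements of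
  \<open>E_poset t L\<close>.

  Let \<open>\<rho>\<close> be \<open>n\<close> on the empty set, \<open>n - 1\<close> on singletons, and \<open>n - (r v - r u)\<close> on \<open>[u, v]\<close>. This
  function vanishes at the bottom element \<open>carrier L\<close> of \<open>E_poset t L\<close>, is strictly increasing for reversed
  inclusion, and every jump of it by more than one is interrupted by some element. A general criterion
  (\<open>rank_function\<close>) then shows that \<open>E_poset t L\<close> is graded with rank function \<open>\<rho>\<close>. Its length is the
  rank \<open>n\<close> of the empty set.

  For the Eulerian property it has to be shown that the signs \<open>(-1) ^ \<rho> C\<close> sum to zero over the \<open>C\<close>
  between any two distinct comparable elements. The sign of a crossing interval is
  \<open>(-1) ^ n * (-1) ^ r u * (-1) ^ r v\<close>. Between two crossing intervals, and between a singleton and a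
  crossing interval, the ends \<open>u\<close> and \<open>v\<close> vary independently, so the sum splits as a product of two
  sums over (possibly half-open) intervals of \<open>L\<close>, which the Eulerian property of \<open>L\<close> evaluates.
  Between the empty set and a crossing interval \<open>[x, z]\<close> the ends are not independent, since they have
  to be comparable. There the claim amounts to the identity \<open>crossing_subintervals_sum\<close>: the signs
  \<open>(-1) ^ (r u + r v)\<close> of the crossing intervals inside \<open>[x, z]\<close> sum to the number of elements of rank
  \<open>t + 1\<close> in \<open>[x, z]\<close>, minus one.\<close>

section \<open>Recognizing the rank function of a graded poset\<close>

lemma finite_obtains_max:
  fixes f :: "'b \<Rightarrow> nat"
  assumes "finite A" "a \<in> A"
  obtains u where "u \<in> A" "\<And>w. w \<in> A \<Longrightarrow> f w \<le> f u"
proof -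
  have "Max (f ` A) \<in> f ` A" by (rule Max_in) (use assms in auto)
  then obtain u where "u \<in> A" "f u = Max (f ` A)" by auto
  then show thesis using that[of u] assms(1) by simp
qed

text \<open>The minimum of a bounded poset lies below every element; reversing the order turns that
  fact into the one about the maximum.\<close>

lemma one_hat_closed_ge:
  assumes L: "bounded_poset L"
  shows one_hat_closed: "one_hat L \<in> carrier L"
    and le_one_hat: "x \<in> carrier L \<Longrightarrow> x \<sqsubseteq>\<^bsub>L\<^esub> one_hat L"
proof -
  have fp: "finite_poset L" using L by (simp add: bounded_poset_def)
  interpret partial_order L using fp by (simp add: finite_poset_def)
  let ?D = "inv_gorder L"
  have fpD: "finite_poset ?D" using fp dual_order by (simp add: finite_poset_def)
  have less: "lless ?D u v \<longleftrightarrow> lless L v u" for u v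
    using lless_iff[OF fp] lless_iff[OF fpD] by auto
  have mn: "minimal_element ?D = maximal_element L" "maximal_element ?D = minimal_element L"
    by (auto simp: fun_eq_iff minimal_element_def maximal_element_def less)
  have bD: "bounded_poset ?D"
    using L fpD by (simp add: bounded_poset_def mn)
  have z: "zero_hat ?D = one_hat L" by (simp add: zero_hat_def one_hat_def mn)
  show "one_hat L \<in> carrier L" using zero_hat_closed[OF bD] z by simp
  show "x \<sqsubseteq>\<^bsub>L\<^esub> one_hat L" if "x \<in> carrier L" using zero_hat_le[OF bD, of x] z that by simp
qed

lemma bounded_posetI:
  assumes fp: "finite_poset P" and a: "a \<in> carrier P" "\<And>x. x \<in> carrier P \<Longrightarrow> a \<sqsubseteq>\<^bsub>P\<^esub> x"
    and b: "b \<in> carrier P" "\<And>x. x \<in> carrier P \<Longrightarrow> x \<sqsubseteq>\<^bsub>P\<^esub> b"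
  shows "bounded_poset P" and "zero_hat P = a" and "one_hat P = b"
proof -
  interpret partial_order P using fp by (simp add: finite_poset_def)
  have "minimal_element P x \<longleftrightarrow> x = a" for x
    unfolding minimal_element_def lless_eq using a le_antisym by metis
  moreover have "maximal_element P x \<longleftrightarrow> x = b" for x
    unfolding maximal_element_def lless_eq using b le_antisym by metis
  ultimately show "bounded_poset P" "zero_hat P = a" "one_hat P = b"
    using fp by (simp_all add: bounded_poset_def zero_hat_def one_hat_def)
qed

text \<open>To show that a bounded poset is graded it suffices to guess its rank function. If \<open>\<rho>\<close> vanishes at the
  bottom, is strictly increasing and every jump of \<open>\<rho>\<close> by more than one can be interrupted by an element in between, then
  \<open>\<rho>\<close> maps each maximal chain bijectively onto \<open>{0, \<dots>, \<rho> (one_hat P)}\<close>: a value missed by the chain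
  would be jumped over by two neighbours of the chain, and the chain could be enlarged there.
  Since \<open>\<rho>\<close> increases by exactly one along covers, it is then the rank.\<close>

lemma rank_function:
  fixes P :: "'b gorder" and \<rho> :: "'b \<Rightarrow> nat"
  assumes bp: "bounded_poset P" and zero: "\<rho> (zero_hat P) = 0"
    and mono: "\<And>x y. x \<in> carrier P \<Longrightarrow> y \<in> carrier P \<Longrightarrow> x \<sqsubset>\<^bsub>P\<^esub> y \<Longrightarrow> \<rho> x < \<rho> y"
    and gap: "\<And>x y. x \<in> carrier P \<Longrightarrow> y \<in> carrier P \<Longrightarrow> x \<sqsubset>\<^bsub>P\<^esub> y \<Longrightarrow> Suc (\<rho> x) < \<rho> y \<Longrightarrow>
      \<exists>z\<in>carrier P. x \<sqsubset>\<^bsub>P\<^esub> z \<and> z \<sqsubset>\<^bsub>P\<^esub> y"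
  shows rank_function_graded: "graded_poset P"
    and rank_function_unique: "x \<in> carrier P \<Longrightarrow> poset_rank P x = \<rho> x"
proof -
  have fp: "finite_poset P" using bp by (simp add: bounded_poset_def)
  interpret partial_order P using fp by (simp add: finite_poset_def)
  have fin: "finite (carrier P)" using fp by (simp add: finite_poset_def)
  note zc = zero_hat_closed[OF bp] and oc = one_hat_closed[OF bp]
    and zl = zero_hat_le[OF bp] and lo = le_one_hat[OF bp]
  have mono': "\<rho> x \<le> \<rho> y" if "x \<in> carrier P" "y \<in> carrier P" "x \<sqsubseteq>\<^bsub>P\<^esub> y" for x y
    using mono[OF that(1,2)] that(3) unfolding lless_eq by fastforce
  have image: "\<rho> ` C = {..\<rho> (one_hat P)}" and inj: "inj_on \<rho> C" 
    if C: "pred_on.maxchain (carrier P) (lless P) C" for C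
  proof -
    have ch: "C \<subseteq> carrier P" "\<And>u v. u \<in> C \<Longrightarrow> v \<in> C \<Longrightarrow> u = v \<or> u \<sqsubseteq>\<^bsub>P\<^esub> v \<or> v \<sqsubseteq>\<^bsub>P\<^esub> u"
      using C unfolding pred_on.maxchain_def chain_iff[OF fp] by blast+
    have ext: "z \<in> C" if "z \<in> carrier P" "\<And>u. u \<in> C \<Longrightarrow> u \<sqsubseteq>\<^bsub>P\<^esub> z \<or> z \<sqsubseteq>\<^bsub>P\<^esub> u" for z
    proof -
      have "pred_on.chain (carrier P) (lless P) (insert z C)"
        unfolding chain_iff[OF fp] using ch that by blast
      then show ?thesis using C unfolding pred_on.maxchain_def by blast
    qed
    have finC: "finite C" using ch(1) fin finite_subset by blast
    have le: "u \<sqsubseteq>\<^bsub>P\<^esub> v" if "u \<in> C" "v \<in> C" "\<rho> u \<le> \<rho> v" for u v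
    proof -
      have c: "u \<in> carrier P" "v \<in> carrier P" using ch(1) that by auto
      have "\<not> (v \<sqsubseteq>\<^bsub>P\<^esub> u \<and> v \<noteq> u)" using mono[of v u] c that(3) unfolding lless_eq by auto
      then show ?thesis using ch(2)[OF that(1,2)] c by auto
    qed
    show "inj_on \<rho> C"
    proof (rule inj_onI)
      fix u v assume "u \<in> C" "v \<in> C" "\<rho> u = \<rho> v"
      then show "u = v" using le[of u v] le[of v u] ch(1) le_antisym[of u v] by auto
    qed
    have z: "zero_hat P \<in> C" using ext[OF zc] ch(1) zl by blast
    have o: "one_hat P \<in> C" using ext[OF oc] ch(1) lo by blast
    have "k \<in> \<rho> ` C" if k: "k \<le> \<rho> (one_hat P)" for k
    proof (rule ccontr)
      assume nk: "k \<notin> \<rho> ` C"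
      \<comment> \<open>The chain jumps over \<open>k\<close> between the last element \<open>u\<close> of \<open>A\<close> and the first element \<open>v\<close> of \<open>B\<close>.\<close>
      define A where "A = {u \<in> C. \<rho> u < k}"
      define B where "B = {u \<in> C. k < \<rho> u}"
      have "k \<noteq> 0" "k \<noteq> \<rho> (one_hat P)" using nk z o zero by (auto simp: image_iff)
      then have zA: "zero_hat P \<in> A" and oB: "one_hat P \<in> B"
        using z o k zero by (auto simp: A_def B_def)
      have fAB: "finite A" "finite B" using finC by (auto simp: A_def B_def)
      obtain u where u: "u \<in> A" "\<And>w. w \<in> A \<Longrightarrow> \<rho> w \<le> \<rho> u"
        using finite_obtains_max[OF fAB(1) zA, of \<rho>] by blast
      obtain v where v: "v \<in> B" "\<And>w. w \<in> B \<Longrightarrow> \<rho> v \<le> \<rho> w"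
        using arg_min_nat_lemma[of "\<lambda>w. w \<in> B", OF oB, of \<rho>] by blast
      have uv: "u \<in> C" "v \<in> C" "\<rho> u < k" "k < \<rho> v" using u v by (auto simp: A_def B_def)
      have uvc: "u \<in> carrier P" "v \<in> carrier P" using uv ch(1) by auto
      have "u \<sqsubset>\<^bsub>P\<^esub> v" using le[OF uv(1,2)] uv unfolding lless_eq by auto
      then obtain w where w: "w \<in> carrier P" "u \<sqsubset>\<^bsub>P\<^esub> w" "w \<sqsubset>\<^bsub>P\<^esub> v"
        using gap[OF uvc] uv by auto
      have uw: "u \<sqsubseteq>\<^bsub>P\<^esub> w" "w \<sqsubseteq>\<^bsub>P\<^esub> v" "\<rho> u < \<rho> w" "\<rho> w < \<rho> v"
        using w uvc mono by (auto simp: lless_eq)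
      have "w \<in> C"
      proof (rule ext[OF w(1)])
        fix c assume c: "c \<in> C"
        then have cc: "c \<in> carrier P" using ch(1) by blast
        have "\<rho> c \<noteq> k" using nk c by blast
        then consider "c \<in> A" | "c \<in> B" using c by (fastforce simp: A_def B_def)
        then show "c \<sqsubseteq>\<^bsub>P\<^esub> w \<or> w \<sqsubseteq>\<^bsub>P\<^esub> c"
        proof cases
          case 1
          then have "c \<sqsubseteq>\<^bsub>P\<^esub> u" using le[OF c uv(1)] u(2) by blast
          then show ?thesis using le_trans[OF _ uw(1)] cc uvc w(1) by blast
        next
          case 2
          then have "v \<sqsubseteq>\<^bsub>P\<^esub> c" using le[OF uv(2) c] v(2) by blast
          then show ?thesis using le_trans[OF uw(2)] cc uvc w(1) by blast
        qed
      qed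
      moreover have "\<rho> w \<noteq> k" using nk \<open>w \<in> C\<close> by blast
      ultimately have "w \<in> A \<or> w \<in> B" by (auto simp: A_def B_def)
      then show False using u(2)[of w] v(2)[of w] uw by auto
    qed
    then show "\<rho> ` C = {..\<rho> (one_hat P)}" using ch(1) mono' oc lo by auto
  qed
  have "card C = Suc (\<rho> (one_hat P))" if "pred_on.maxchain (carrier P) (lless P) C" for C
    using card_image[OF inj[OF that]] image[OF that] by simp
  then show g: "graded_poset P"
    using bp by (auto simp: graded_poset_def chain_length_def)
  show "poset_rank P x = \<rho> x" if "x \<in> carrier P" for x
    using that
  proof (induction "\<rho> x" arbitrary: x rule: less_induct)
    case less
    show ?case
    proof (cases "x = zero_hat P")
      case True
      then show ?thesis using zero poset_rank_zero_hat[OF bp] by simp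
    next
      case False
      \<comment> \<open>An element \<open>w\<close> below \<open>x\<close> with \<open>\<rho> w\<close> largest possible is covered by \<open>x\<close>.\<close>
      define A where "A = {w \<in> carrier P. w \<sqsubset>\<^bsub>P\<^esub> x}"
      have zA: "zero_hat P \<in> A" using False zl zc less.prems by (auto simp: A_def lless_eq)
      have "finite A" using fin by (auto simp: A_def)
      then obtain w where w: "w \<in> A" "\<And>v. v \<in> A \<Longrightarrow> \<rho> v \<le> \<rho> w"
        using finite_obtains_max[OF _ zA, of \<rho>] by blast
      have wc: "w \<in> carrier P" "w \<sqsubset>\<^bsub>P\<^esub> x" using w by (auto simp: A_def)
      have cov: "\<not> (\<exists>z\<in>carrier P. w \<sqsubset>\<^bsub>P\<^esub> z \<and> z \<sqsubset>\<^bsub>P\<^esub> x)"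
        using w(2) mono[OF wc(1)] unfolding A_def by force
      then have "\<rho> x = Suc (\<rho> w)"
        using gap[OF wc(1) less.prems wc(2)] mono[OF wc(1) less.prems wc(2)] by linarith
      moreover have "poset_rank P x = Suc (poset_rank P w)"
        using poset_rank_cover[OF g wc(1) less.prems wc(2) cov] .
      ultimately show ?thesis using less.hyps[of w] wc by simp
    qed
  qed
qed

section \<open>Ranks and intervals in a graded poset\<close>

locale finite_graded_poset =
  fixes L :: "'a gorder" (structure)
  assumes graded: "graded_poset L"
begin

lemma bounded: "bounded_poset L"
  using graded by (simp add: graded_poset_def)

lemma finite_poset: "finite_poset L"
  using bounded by (simp add: bounded_poset_def)

lemma finite_carrier: "finite (carrier L)"
  using finite_poset by (simp add: finite_poset_def)

end

sublocale finite_graded_poset \<subseteq> partial_order L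
  using finite_poset by (simp add: finite_poset_def)

context finite_graded_poset
begin

abbreviation rk :: "'a \<Rightarrow> nat" where "rk \<equiv> poset_rank L"

lemma finite_interval: "finite \<lbrace>x..y\<rbrace>"
  using finite_carrier by (simp add: at_least_at_most_def)

lemma in_interval: "w \<in> \<lbrace>x..y\<rbrace> \<longleftrightarrow> w \<in> carrier L \<and> x \<sqsubseteq> w \<and> w \<sqsubseteq> y"
  by (simp add: at_least_at_most_def)

text \<open>Covers raise the rank by exactly one, so a larger jump is not a cover.\<close>

lemma gap_filling:
  assumes "x \<in> carrier L" "y \<in> carrier L" "x \<sqsubset> y" "Suc (rk x) < rk y"
  shows "\<exists>z\<in>carrier L. x \<sqsubset> z \<and> z \<sqsubset> y"
  using poset_rank_cover[OF graded assms(1-3)] assms(4) by auto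

lemma rank_strict_mono:
  assumes "x \<in> carrier L" "y \<in> carrier L" "x \<sqsubset> y"
  shows "rk x < rk y"
  using assms
proof (induction "card \<lbrace>x..y\<rbrace>" arbitrary: x y rule: less_induct)
  case less
  show ?case
  proof (cases "\<exists>z\<in>carrier L. x \<sqsubset> z \<and> z \<sqsubset> y")
    case True
    then obtain z where z: "z \<in> carrier L" "x \<sqsubset> z" "z \<sqsubset> y" by blast
    have le: "x \<sqsubseteq> z" "z \<sqsubseteq> y" "x \<sqsubseteq> y" "\<not> y \<sqsubseteq> z" "\<not> z \<sqsubseteq> x"
      using z less.prems le_antisym[of y z] le_antisym[of z x] by (auto simp: lless_eq)
    have "\<lbrace>x..z\<rbrace> \<subseteq> \<lbrace>x..y\<rbrace>" "\<lbrace>z..y\<rbrace> \<subseteq> \<lbrace>x..y\<rbrace>"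
      using le z less.prems le_trans[of _ z y] le_trans[of x z] by (auto simp: in_interval)
    moreover have "x \<in> \<lbrace>x..y\<rbrace>" "x \<notin> \<lbrace>z..y\<rbrace>" "y \<in> \<lbrace>x..y\<rbrace>" "y \<notin> \<lbrace>x..z\<rbrace>"
      using le less.prems by (auto simp: in_interval)
    ultimately have "card \<lbrace>x..z\<rbrace> < card \<lbrace>x..y\<rbrace>" "card \<lbrace>z..y\<rbrace> < card \<lbrace>x..y\<rbrace>"
      using finite_interval by (metis psubset_card_mono psubsetI)+
    then show ?thesis
      using less.hyps[of x z] less.hyps[of z y] less.prems z by simp
  next
    case False
    then show ?thesis using poset_rank_cover[OF graded less.prems] by simp
  qed
qed

lemma rank_mono: "x \<in> carrier L \<Longrightarrow> y \<in> carrier L \<Longrightarrow> x \<sqsubseteq> y \<Longrightarrow> rk x \<le> rk y"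
  using rank_strict_mono[of x y] unfolding lless_eq by fastforce

text \<open>Climbing along covers never skips a rank, so an interval with endpoints on both sides of a level
  meets that level.\<close>

lemma intermediate_rank:
  assumes x: "x \<in> carrier L" and z: "z \<in> carrier L" and xz: "x \<sqsubseteq> z"
    and k: "rk x < k" "k < rk z"
  obtains y where "y \<in> carrier L" "x \<sqsubset> y" "y \<sqsubset> z" "rk y = k"
proof -
  define A where "A = {w \<in> \<lbrace>x..z\<rbrace>. rk w \<le> k}"
  have "x \<in> A" "finite A" using x xz k finite_carrier by (auto simp: A_def in_interval)
  then obtain u where u: "u \<in> A" "\<And>w. w \<in> A \<Longrightarrow> rk w \<le> rk u"
    using finite_obtains_max[of A x rk] by blast
  have uc: "u \<in> carrier L" "x \<sqsubseteq> u" "u \<sqsubseteq> z" "rk u \<le> k" using u by (auto simp: A_def in_interval)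
  \<comment> \<open>An element \<open>v\<close> of lowest rank in \<open>B\<close> covers \<open>u\<close>, hence has rank \<open>rk u + 1\<close>; by the choice of
    \<open>u\<close> this exceeds \<open>k\<close>.\<close>
  define B where "B = {w \<in> \<lbrace>u..z\<rbrace>. w \<noteq> u}"
  have "z \<in> B" using z uc k by (auto simp: B_def in_interval)
  then obtain v where v: "v \<in> B" "\<And>w. w \<in> B \<Longrightarrow> rk v \<le> rk w"
    using arg_min_nat_lemma[of "\<lambda>w. w \<in> B" z rk] by blast
  have vc: "v \<in> carrier L" "u \<sqsubset> v" "v \<sqsubseteq> z" using v by (auto simp: B_def in_interval lless_eq)
  have "\<not> (\<exists>w\<in>carrier L. u \<sqsubset> w \<and> w \<sqsubset> v)"
  proof clarify
    fix w assume w: "w \<in> carrier L" "u \<sqsubset> w" "w \<sqsubset> v"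
    then have "w \<in> B" using vc z uc le_trans[of w v z] by (auto simp: B_def in_interval lless_eq)
    then show False using v(2)[of w] rank_strict_mono[OF w(1) vc(1) w(3)] by simp
  qed
  then have rv: "rk v = Suc (rk u)" using poset_rank_cover[OF graded uc(1) vc(1,2)] by blast
  have "x \<sqsubseteq> v" using le_trans[of x u v] x uc vc by (auto simp: lless_eq)
  then have "\<not> rk v \<le> k" using u(2)[of v] rv vc by (auto simp: A_def in_interval)
  then have "rk u = k" using rv uc by simp
  then show thesis using that[of u] uc k by (auto simp: lless_eq)
qed

text \<open>A nonempty interval determines its endpoints, and shrinking it moves them inwards. So the
  intervals, ordered by reversed inclusion, behave like pairs \<open>(lower end, upper end)\<close> in the product of
  the order and its dual.\<close>

lemma intervals_nested_iff:
  assumes "x \<in> carrier L" "z \<in> carrier L" "u \<in> carrier L" "v \<in> carrier L" "u \<sqsubseteq> v"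
  shows "\<lbrace>u..v\<rbrace> \<subseteq> \<lbrace>x..z\<rbrace> \<longleftrightarrow> x \<sqsubseteq> u \<and> v \<sqsubseteq> z"
  using assms le_trans[of x u] le_trans[of _ v z] by (auto simp: in_interval subset_iff)

lemma interval_inject:
  assumes "x \<in> carrier L" "z \<in> carrier L" "u \<in> carrier L" "v \<in> carrier L" "u \<sqsubseteq> v" "x \<sqsubseteq> z"
    and eq: "\<lbrace>u..v\<rbrace> = \<lbrace>x..z\<rbrace>"
  shows "u = x \<and> v = z"
proof -
  have "x \<sqsubseteq> u \<and> v \<sqsubseteq> z" "u \<sqsubseteq> x \<and> z \<sqsubseteq> v"
    using intervals_nested_iff[of x z u v] intervals_nested_iff[of u v x z] assms by auto
  then show ?thesis using assms le_antisym by blast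
qed

lemma intervals_strictly_nested_iff:
  assumes "x \<in> carrier L" "z \<in> carrier L" "u \<in> carrier L" "v \<in> carrier L" "u \<sqsubseteq> v" "x \<sqsubseteq> z"
  shows "\<lbrace>u..v\<rbrace> \<subset> \<lbrace>x..z\<rbrace> \<longleftrightarrow> x \<sqsubseteq> u \<and> v \<sqsubseteq> z \<and> (u \<noteq> x \<or> v \<noteq> z)"
  unfolding psubset_eq intervals_nested_iff[OF assms(1-5)] using interval_inject[OF assms] by blast

end

section \<open>The poset \<open>E_poset t L\<close> is graded\<close>

locale graded_poset_level = finite_graded_poset +
  fixes t :: nat
  assumes level_inside: "Suc t < poset_length L"
begin

abbreviation E :: "'a set gorder" where "E \<equiv> E_poset t L"

text \<open>Recording the endpoints rather than the interval, and comparing ranks rather than asking for an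
  element of the level strictly in between, makes the sums below range over pairs described by order
  and rank alone. The elements of \<open>level L t\<close> have rank \<open>Suc t\<close>.\<close>

definition crossing :: "('a \<times> 'a) set" where
  "crossing = {(u, v). u \<in> carrier L \<and> v \<in> carrier L \<and> u \<sqsubseteq> v \<and> rk u \<le> t \<and> Suc t < rk v}"

lemma crossing_iff:
  assumes "u \<in> carrier L" "v \<in> carrier L"
  shows "(\<exists>y\<in>level L t. u \<sqsubset> y \<and> y \<sqsubset> v) \<longleftrightarrow> (u, v) \<in> crossing"
proof
  assume "\<exists>y\<in>level L t. u \<sqsubset> y \<and> y \<sqsubset> v"
  then obtain y where y: "y \<in> carrier L" "rk y = Suc t" "u \<sqsubset> y" "y \<sqsubset> v"
    by (auto simp: level_def)
  then show "(u, v) \<in> crossing"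
    using assms rank_strict_mono[of u y] rank_strict_mono[of y v] le_trans[of u y v]
    by (auto simp: crossing_def lless_eq)
next
  assume "(u, v) \<in> crossing"
  then obtain y where "y \<in> carrier L" "u \<sqsubset> y" "y \<sqsubset> v" "rk y = Suc t"
    using intermediate_rank[of u v "Suc t"] by (auto simp: crossing_def)
  then show "\<exists>y\<in>level L t. u \<sqsubset> y \<and> y \<sqsubset> v"
    by (auto simp: level_def)
qed

lemma E_carrier:
  "carrier E = insert {} ((\<lambda>y. {y}) ` level L t \<union> (\<lambda>(u, v). \<lbrace>u..v\<rbrace>) ` crossing)"
proof -
  have "{\<lbrace>x..z\<rbrace> | x z. x \<in> carrier L \<and> z \<in> carrier L \<and> (\<exists>y\<in>level L t. x \<sqsubset> y \<and> y \<sqsubset> z)}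
      = {\<lbrace>x..z\<rbrace> | x z. x \<in> carrier L \<and> z \<in> carrier L \<and> (x, z) \<in> crossing}"
    by (intro Collect_cong ex_cong1 conj_cong) (simp_all add: crossing_iff)
  also have "\<dots> = (\<lambda>(u, v). \<lbrace>u..v\<rbrace>) ` crossing"
    by (auto simp: crossing_def)
  finally show ?thesis by (auto simp: E_poset_def)
qed

lemma crossingD:
  assumes "(u, v) \<in> crossing"
  shows "u \<in> carrier L" "v \<in> carrier L" "u \<sqsubseteq> v" "rk u \<le> t" "Suc t < rk v"
    "u \<in> \<lbrace>u..v\<rbrace>" "v \<in> \<lbrace>u..v\<rbrace>"
  using assms by (auto simp: crossing_def in_interval)

lemma E_cases [consumes 1, case_names empty point interval]:
  assumes "A \<in> carrier E"
  obtains "A = {}"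
  | y where "A = {y}" "y \<in> carrier L" "rk y = Suc t"
  | u v where "A = \<lbrace>u..v\<rbrace>" "(u, v) \<in> crossing"
  using assms unfolding E_carrier level_def by auto

lemma E_memI:
  "{} \<in> carrier E"
  "y \<in> carrier L \<Longrightarrow> rk y = Suc t \<Longrightarrow> {y} \<in> carrier E"
  "(u, v) \<in> crossing \<Longrightarrow> \<lbrace>u..v\<rbrace> \<in> carrier E"
  unfolding E_carrier level_def by auto

lemma crossing_interval_not_subset_singleton: 
  assumes "(u, v) \<in> crossing"
  shows "\<not> \<lbrace>u..v\<rbrace> \<subseteq> {y}"
proof
  assume "\<lbrace>u..v\<rbrace> \<subseteq> {y}"
  then have "u = v" using crossingD(6,7)[OF assms] by blast
  then show False using crossingD(4,5)[OF assms] by simp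
qed

lemma crossing_interval_neq:
  assumes "(u, v) \<in> crossing"
  shows "\<lbrace>u..v\<rbrace> \<noteq> {}" "{} \<noteq> \<lbrace>u..v\<rbrace>" "\<lbrace>u..v\<rbrace> \<noteq> {y}" "{y} \<noteq> \<lbrace>u..v\<rbrace>"
  using crossing_interval_not_subset_singleton[OF assms] by auto

text \<open>Enlarging a crossing interval gives a crossing interval. This is why the two
  endpoints of the intervals between two given crossing intervals can be chosen independently.\<close>

lemma crossing_interval_mono:
  assumes "(x, z) \<in> crossing" "u \<in> carrier L" "v \<in> carrier L" "u \<sqsubseteq> x" "z \<sqsubseteq> v"
  shows "(u, v) \<in> crossing"
proof -
  note xz = crossingD[OF assms(1)]
  have "rk u \<le> rk x" "rk z \<le> rk v" using rank_mono assms xz by auto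
  moreover have "u \<sqsubseteq> v" using le_trans assms xz by meson
  ultimately show ?thesis using assms xz by (simp add: crossing_def)
qed

lemma le_E: "A \<sqsubseteq>\<^bsub>E\<^esub> B \<longleftrightarrow> B \<subseteq> A"
  by (simp add: E_poset_def)

lemma lless_E: "A \<sqsubset>\<^bsub>E\<^esub> B \<longleftrightarrow> B \<subset> A"
  by (auto simp: lless_def E_poset_def)

lemma finite_poset_E: "finite_poset E"
proof -
  have "carrier E \<subseteq> Pow (carrier L)"
    unfolding E_carrier level_def by (auto simp: in_interval)
  then have "finite (carrier E)" using finite_carrier finite_subset by blast
  moreover have "partial_order E"
    by unfold_locales (auto simp: E_poset_def)
  ultimately show ?thesis by (simp add: finite_poset_def)
qed

text \<open>The height of \<open>A\<close> above the bottom of the inclusion order on \<open>E\<close>, so that \<open>poset_length L - corank A\<close>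
  is going to be the rank in the reversed order. Singletons need their own clause: the ranks in them
  have spread zero, but they lie one step above the empty set.\<close>

definition corank :: "'a set \<Rightarrow> nat" where
  "corank A = (if card A \<le> 1 then card A else Max (rk ` A) - Min (rk ` A))"

lemma corank_simps [simp]: "corank {} = 0" "corank {y} = 1"
  by (simp_all add: corank_def)

lemma corank_interval:
  assumes uv: "(u, v) \<in> crossing"
  shows "corank \<lbrace>u..v\<rbrace> = rk v - rk u"
proof -
  note D = crossingD[OF uv]
  have "card {u, v} \<le> card \<lbrace>u..v\<rbrace>"
    by (rule card_mono[OF finite_interval]) (use D in auto)
  then have "\<not> card \<lbrace>u..v\<rbrace> \<le> 1" using D by (auto simp: card_insert_if split: if_splits)
  moreover have "Max (rk ` \<lbrace>u..v\<rbrace>) = rk v"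
    by (rule Max_eqI) (use D finite_interval rank_mono in \<open>auto simp: in_interval\<close>)
  moreover have "Min (rk ` \<lbrace>u..v\<rbrace>) = rk u"
    by (rule Min_eqI) (use D finite_interval rank_mono in \<open>auto simp: in_interval\<close>)
  ultimately show ?thesis by (simp add: corank_def)
qed

lemma rank_le_length: "x \<in> carrier L \<Longrightarrow> rk x \<le> poset_length L"
  unfolding poset_length_def
  using rank_mono le_one_hat[OF bounded] one_hat_closed[OF bounded] by blast

lemma zero_one_crossing: "(zero_hat L, one_hat L) \<in> crossing"
  using level_inside zero_hat_closed[OF bounded] one_hat_closed[OF bounded]
    le_one_hat[OF bounded] poset_rank_zero_hat[OF bounded]
  by (auto simp: crossing_def poset_length_def)

lemma interval_zero_one: "\<lbrace>zero_hat L..one_hat L\<rbrace> = carrier L"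
  using zero_hat_le[OF bounded] le_one_hat[OF bounded] by (auto simp: in_interval)

lemma corank_le_length:
  assumes "A \<in> carrier E"
  shows "corank A \<le> poset_length L"
  using assms
proof (cases rule: E_cases)
  case (interval u v)
  then show ?thesis using rank_le_length[of v] crossingD[of u v] by (simp add: corank_interval)
qed (use level_inside in auto)

text \<open>Shrinking a crossing interval moves an endpoint, which lowers the rank spread. A crossing interval
  has spread at least two, which puts it above the singletons.\<close>

lemma corank_strict_mono:
  assumes A: "A \<in> carrier E" and B: "B \<in> carrier E" and BA: "B \<subset> A"
  shows "corank B < corank A"
  using A
proof (cases rule: E_cases)
  case empty
  then show ?thesis using BA by simp
next
  case (point y)
  then have "B = {}" using BA by auto
  then show ?thesis using point by simp
next
  case (interval x z)
  note A_eq = interval(1) and xz = crossingD[OF interval(2)]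
  have cA: "corank A = rk z - rk x" using interval corank_interval by simp
  from B show ?thesis
  proof (cases rule: E_cases)
    case (interval u v)
    note uv = crossingD[OF interval(2)]
    have n: "x \<sqsubseteq> u" "v \<sqsubseteq> z" "u \<noteq> x \<or> v \<noteq> z"
      using BA interval(1) A_eq intervals_strictly_nested_iff[of x z u v] xz uv by auto
    then have "rk x < rk u \<or> rk v < rk z"
      using rank_strict_mono[of x u] rank_strict_mono[of v z] xz uv by (auto simp: lless_eq)
    moreover have "rk x \<le> rk u" "rk v \<le> rk z" using n xz uv rank_mono by auto
    ultimately show ?thesis
      using cA uv corank_interval[OF interval(2)] interval(1) by auto
  qed (use cA xz in auto)
qed

text \<open>A crossing interval is separated from the empty set by a singleton, and from a smaller crossing
  interval by moving only one endpoint, or moving it only part of the way. It is separated from a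
  singleton \<open>{y}\<close> by moving one endpoint towards \<open>y\<close>: the gap makes the spread \<open>rk z - rk x\<close> exceed two,
  so \<open>y\<close> does not cover \<open>x\<close> or is not covered by \<open>z\<close>.\<close>

lemma E_gap_filling:
  assumes A: "A \<in> carrier E" and B: "B \<in> carrier E" and BA: "B \<subset> A"
    and gap: "Suc (corank B) < corank A"
  shows "\<exists>C\<in>carrier E. B \<subset> C \<and> C \<subset> A"
  using A
proof (cases rule: E_cases)
  case (interval x z)
  note A_eq = interval(1) and xz_cr = interval(2)
  note xz = crossingD[OF xz_cr]
  have cA: "corank A = rk z - rk x" using interval corank_interval by simp
  have shrink: "\<exists>C\<in>carrier E. B \<subset> C \<and> C \<subset> A"
    if "(u, v) \<in> crossing" "x \<sqsubseteq> u" "v \<sqsubseteq> z" "u \<noteq> x \<or> v \<noteq> z" "B \<subset> \<lbrace>u..v\<rbrace>" for u v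
  proof -
    have "\<lbrace>u..v\<rbrace> \<subset> A"
      using intervals_strictly_nested_iff[of x z u v] that xz crossingD[OF that(1)] A_eq by simp
    with that(5) show ?thesis by (intro bexI[OF _ E_memI(3)[OF that(1)]] conjI)
  qed
  from B show ?thesis
  proof (cases rule: E_cases)
    case empty
    obtain y where y: "y \<in> carrier L" "x \<sqsubset> y" "y \<sqsubset> z" "rk y = Suc t"
      using intermediate_rank[of x z "Suc t"] xz by auto
    then have "y \<in> A" using A_eq by (simp add: in_interval lless_eq)
    then have "{y} \<subset> A"
      using crossing_interval_not_subset_singleton[OF xz_cr, of y] A_eq by blast
    then show ?thesis using empty by (intro bexI[OF _ E_memI(2)[OF y(1,4)]]) auto
  next
    case (point y)
    have yz: "x \<sqsubseteq> y" "y \<sqsubseteq> z" using BA point A_eq by (auto simp: in_interval)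
    have xyz: "x \<sqsubset> y" "y \<sqsubset> z" using yz xz point by (auto simp: lless_eq)
    have "Suc (rk x) < rk y \<or> Suc (rk y) < rk z" using gap cA point by auto
    then show ?thesis
    proof
      assume "Suc (rk x) < rk y"
      then obtain w where w: "w \<in> carrier L" "x \<sqsubset> w" "w \<sqsubset> y"
        using gap_filling xz point xyz by blast
      have "(w, z) \<in> crossing"
        using w xz point xyz rank_strict_mono[of w y] le_trans[of w y z]
        by (auto simp: crossing_def lless_eq)
      moreover have "y \<in> \<lbrace>w..z\<rbrace>" using point w xyz by (simp add: in_interval lless_eq)
      then have "B \<subset> \<lbrace>w..z\<rbrace>"
        using point(1) crossing_interval_not_subset_singleton[OF \<open>(w, z) \<in> crossing\<close>]
        by blast
      ultimately show ?thesis using shrink[of w z] w xz by (auto simp: lless_eq)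
    next
      assume "Suc (rk y) < rk z"
      then obtain w where w: "w \<in> carrier L" "y \<sqsubset> w" "w \<sqsubset> z"
        using gap_filling xz point xyz by blast
      have "(x, w) \<in> crossing"
        using w xz point xyz rank_strict_mono[of y w] le_trans[of x y w]
        by (auto simp: crossing_def lless_eq)
      moreover have "y \<in> \<lbrace>x..w\<rbrace>" using point w xyz by (simp add: in_interval lless_eq)
      then have "B \<subset> \<lbrace>x..w\<rbrace>"
        using point(1) crossing_interval_not_subset_singleton[OF \<open>(x, w) \<in> crossing\<close>]
        by blast
      ultimately show ?thesis using shrink[of x w] w xz by (auto simp: lless_eq)
    qed
  next
    case (interval u v)
    note uv = crossingD[OF interval(2)]
    have n: "x \<sqsubseteq> u" "v \<sqsubseteq> z"
      using BA interval(1) A_eq intervals_strictly_nested_iff[of x z u v] xz uv by auto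
    have sub: "B \<subset> \<lbrace>u'..v'\<rbrace>"
      if "(u', v') \<in> crossing" "u' \<sqsubseteq> u" "v \<sqsubseteq> v'" "u' \<noteq> u \<or> v' \<noteq> v" for u' v'
      using intervals_strictly_nested_iff[of u' v' u v] that uv crossingD[OF that(1)] interval(1)
      by auto
    have cB: "corank B = rk v - rk u" using interval corank_interval by simp
    have r: "rk x \<le> rk u" "rk v \<le> rk z" using n uv xz rank_mono by auto
    consider "u \<noteq> x" "v \<noteq> z" | "u = x" "Suc (rk v) < rk z" | "v = z" "Suc (rk x) < rk u"
      using gap cA cB r uv by fastforce
    then show ?thesis
    proof cases
      case 1
      have "(x, v) \<in> crossing" using crossing_interval_mono[OF interval(2)] xz uv n by blast
      then show ?thesis using shrink[of x v] sub[of x v] 1 n xz uv by auto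
    next
      case 2
      then have "v \<sqsubset> z" using n by (auto simp: lless_eq)
      with 2 obtain w where w: "w \<in> carrier L" "v \<sqsubset> w" "w \<sqsubset> z"
        using gap_filling[of v z] xz uv by blast
      then have "(x, w) \<in> crossing"
        using crossing_interval_mono[OF interval(2)] xz uv n by (auto simp: lless_eq)
      then show ?thesis using shrink[of x w] sub[of x w] 2 w xz uv by (auto simp: lless_eq)
    next
      case 3
      then have "x \<sqsubset> u" using n by (auto simp: lless_eq)
      with 3 obtain w where w: "w \<in> carrier L" "x \<sqsubset> w" "w \<sqsubset> u"
        using gap_filling[of x u] xz uv by blast
      then have "(w, z) \<in> crossing"
        using crossing_interval_mono[OF interval(2)] xz uv n by (auto simp: lless_eq)
      then show ?thesis using shrink[of w z] sub[of w z] 3 w xz uv by (auto simp: lless_eq)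
    qed
  qed
qed (use gap in auto)

lemma E_bounded: "bounded_poset E" "zero_hat E = carrier L" "one_hat E = {}"
proof -
  have top: "carrier L \<in> carrier E"
    using E_memI(3)[OF zero_one_crossing] interval_zero_one by simp
  have sub: "A \<subseteq> carrier L" if "A \<in> carrier E" for A
    using that by (cases rule: E_cases) (auto simp: in_interval)
  show "bounded_poset E" "zero_hat E = carrier L" "one_hat E = {}"
    using bounded_posetI[OF finite_poset_E, of "carrier L" "{}"] top sub E_memI(1)
    by (simp_all add: le_E)
qed

text \<open>The criterion for rank functions applies to \<open>poset_length L - corank A\<close>; the truncated subtraction is
  harmless because no corank exceeds the length.\<close>

lemma E_graded_rank:
  shows E_graded: "graded_poset E"
    and E_rank: "A \<in> carrier E \<Longrightarrow> poset_rank E A = poset_length L - corank A"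
proof -
  let ?\<rho> = "\<lambda>A. poset_length L - corank A"
  have zero: "?\<rho> (zero_hat E) = 0"
    using corank_interval[OF zero_one_crossing] poset_rank_zero_hat[OF bounded]
    by (simp add: interval_zero_one E_bounded(2) poset_length_def)
  have mono: "?\<rho> A < ?\<rho> B" if "A \<in> carrier E" "B \<in> carrier E" "A \<sqsubset>\<^bsub>E\<^esub> B" for A B
    using corank_strict_mono[OF that(1,2)] corank_le_length[OF that(1)] that(3)
    by (simp add: lless_E)
  have gap: "\<exists>C\<in>carrier E. A \<sqsubset>\<^bsub>E\<^esub> C \<and> C \<sqsubset>\<^bsub>E\<^esub> B"
    if "A \<in> carrier E" "B \<in> carrier E" "A \<sqsubset>\<^bsub>E\<^esub> B" "Suc (?\<rho> A) < ?\<rho> B" for A B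
  proof -
    have "Suc (corank B) < corank A"
      using that(4) corank_le_length[OF that(1)] corank_le_length[OF that(2)] by linarith
    then show ?thesis using E_gap_filling[OF that(1,2)] that(3) unfolding lless_E by blast
  qed
  show "graded_poset E" by (rule rank_function_graded[where \<rho> = ?\<rho>, OF E_bounded(1) zero mono gap])
  show "A \<in> carrier E \<Longrightarrow> poset_rank E A = ?\<rho> A"
    by (rule rank_function_unique[where \<rho> = ?\<rho>, OF E_bounded(1) zero mono gap])
qed

lemma E_length: "poset_length E = poset_length L"
  by (simp add: poset_length_def[of E] E_bounded(3) E_rank E_memI(1))

end

section \<open>Signed sums over intervals of an Eulerian poset\<close>

lemma signed_sum_eq:
  assumes "finite A"
  shows "(\<Sum>z\<in>A. (- 1 :: int) ^ f z) = int (card {z \<in> A. even (f z)}) - int (card {z \<in> A. odd (f z)})"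
proof -
  have "A = {z \<in> A. even (f z)} \<union> {z \<in> A. odd (f z)}" by auto
  then have "(\<Sum>z\<in>A. (- 1 :: int) ^ f z) =
      (\<Sum>z\<in>{z \<in> A. even (f z)} \<union> {z \<in> A. odd (f z)}. (- 1) ^ f z)" by simp
  also have "\<dots> = (\<Sum>z\<in>{z \<in> A. even (f z)}. (- 1) ^ f z) + (\<Sum>z\<in>{z \<in> A. odd (f z)}. (- 1) ^ f z)"
    by (rule sum.union_disjoint) (use assms in auto)
  also have "\<dots> = (\<Sum>z\<in>{z \<in> A. even (f z)}. 1) + (\<Sum>z\<in>{z \<in> A. odd (f z)}. - 1)"
    by (intro arg_cong2[of _ _ _ _ "(+)"] sum.cong) auto
  finally show ?thesis by simp
qed

text \<open>The vanishing of the alternating sum is the form of the Eulerian condition that is compatible with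
  decomposing intervals and exchanging summations.\<close>

lemma eulerian_poset_iff_signed_sum:
  assumes "graded_poset P"
  shows "eulerian_poset P \<longleftrightarrow> (\<forall>x\<in>carrier P. \<forall>y\<in>carrier P. x \<sqsubset>\<^bsub>P\<^esub> y \<longrightarrow>
    (\<Sum>z\<in>\<lbrace>x..y\<rbrace>\<^bsub>P\<^esub>. (- 1 :: int) ^ poset_rank P z) = 0)"
proof -
  have "finite \<lbrace>x..y\<rbrace>\<^bsub>P\<^esub>" for x y
    using finite_graded_poset.finite_interval[OF finite_graded_poset.intro[OF assms]] .
  then show ?thesis using assms by (auto simp: eulerian_poset_def signed_sum_eq)
qed


locale finite_eulerian_poset =
  fixes L :: "'a gorder" (structure)
  assumes eulerian: "eulerian_poset L"

sublocale finite_eulerian_poset \<subseteq> finite_graded_poset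
  using eulerian by unfold_locales (simp add: eulerian_poset_def)

context finite_eulerian_poset
begin

abbreviation sign :: "'a \<Rightarrow> int" where "sign x \<equiv> (- 1) ^ rk x"

lemma sign_sum_interval:
  assumes "x \<in> carrier L" "y \<in> carrier L" "x \<sqsubset> y"
  shows "(\<Sum>w\<in>\<lbrace>x..y\<rbrace>. sign w) = 0"
  using eulerian assms eulerian_poset_iff_signed_sum[OF graded] by blast

lemma sign_sum_interval_minus_top:
  assumes "x \<in> carrier L" "y \<in> carrier L" "x \<sqsubset> y"
  shows "(\<Sum>w\<in>\<lbrace>x..y\<rbrace> - {y}. sign w) = - sign y"
  using assms sign_sum_interval[OF assms] finite_interval
  by (simp add: sum_diff1 in_interval lless_eq)

lemma sign_sum_interval_minus_bot:
  assumes "x \<in> carrier L" "y \<in> carrier L" "x \<sqsubset> y"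
  shows "(\<Sum>w\<in>\<lbrace>x..y\<rbrace> - {x}. sign w) = - sign x"
  using assms sign_sum_interval[OF assms] finite_interval
  by (simp add: sum_diff1 in_interval lless_eq)

lemma sign_sum_interval_refl:
  assumes "x \<in> carrier L"
  shows "(\<Sum>w\<in>\<lbrace>x..x\<rbrace>. sign w) = sign x"
proof -
  have "\<lbrace>x..x\<rbrace> = {x}" using assms le_antisym by (auto simp: in_interval)
  then show ?thesis by simp
qed

lemma sign_sum_product:
  "(\<Sum>(u, v)\<in>A \<times> B. sign u * sign v) = (\<Sum>u\<in>A. sign u) * (\<Sum>v\<in>B. sign v)"
  by (simp add: sum_product sum.cartesian_product)

end

section \<open>The poset \<open>E_poset t L\<close> is Eulerian\<close>

locale eulerian_poset_level = finite_eulerian_poset + graded_poset_level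
begin

text \<open>This is the combinatorial core: the crossing intervals inside a given one must compensate for the
  elements of the level and for the empty set. For a fixed lower end \<open>u\<close>, the Eulerian condition on the
  interval from \<open>u\<close> to \<open>z\<close> replaces the upper ends \<open>v\<close> above the level by minus those on or below it.
  After exchanging the sums, \<open>u\<close> ranges over the part of the interval from \<open>x\<close> to \<open>v\<close> below the level. If
  \<open>v\<close> is below the level, this is the whole interval, and the sum vanishes except for \<open>v = x\<close>, which
  contributes \<open>-1\<close>. If \<open>v\<close> is on the level, only \<open>v\<close> itself is left out, and the contribution is \<open>+1\<close>.\<close>

lemma crossing_subintervals_sum:
  assumes xz: "(x, z) \<in> crossing"
  shows "(\<Sum>(u, v)\<in>{(u, v) \<in> crossing. x \<sqsubseteq> u \<and> v \<sqsubseteq> z}. sign u * sign v)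
    = int (card {y \<in> \<lbrace>x..z\<rbrace>. rk y = Suc t}) - 1"
proof -
  note D = crossingD[OF xz]
  define low where "low = {u \<in> \<lbrace>x..z\<rbrace>. rk u \<le> t}"
  define mid where "mid = {y \<in> \<lbrace>x..z\<rbrace>. rk y = Suc t}"
  define high where "high = {v \<in> \<lbrace>x..z\<rbrace>. Suc t < rk v}"
  have fin: "finite low" "finite mid" "finite high"
    using finite_interval by (simp_all add: low_def mid_def high_def)
  have split: "{(u, v) \<in> crossing. x \<sqsubseteq> u \<and> v \<sqsubseteq> z} = Sigma low (\<lambda>u. {v \<in> high. u \<sqsubseteq> v})"
    using D le_trans[of x] le_trans[of _ _ z]
    by (auto simp: crossing_def low_def high_def in_interval)
  have above: "(\<Sum>v\<in>{v \<in> high. u \<sqsubseteq> v}. sign v) = - (\<Sum>v\<in>{v \<in> low \<union> mid. u \<sqsubseteq> v}. sign v)"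
    if u: "u \<in> low" for u
  proof -
    have uc: "u \<in> carrier L" "x \<sqsubseteq> u" "u \<sqsubseteq> z" "u \<noteq> z" using u D by (auto simp: low_def in_interval)
    have "\<lbrace>u..z\<rbrace> = {v \<in> high. u \<sqsubseteq> v} \<union> {v \<in> low \<union> mid. u \<sqsubseteq> v}"
      using uc D le_trans[of x u] by (auto simp: low_def mid_def high_def in_interval)
    moreover have "{v \<in> high. u \<sqsubseteq> v} \<inter> {v \<in> low \<union> mid. u \<sqsubseteq> v} = {}"
      by (auto simp: low_def mid_def high_def)
    ultimately have "(\<Sum>v\<in>\<lbrace>u..z\<rbrace>. sign v) =
        (\<Sum>v\<in>{v \<in> high. u \<sqsubseteq> v}. sign v) + (\<Sum>v\<in>{v \<in> low \<union> mid. u \<sqsubseteq> v}. sign v)"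
      using fin by (simp add: sum.union_disjoint)
    then show ?thesis using sign_sum_interval[of u z] uc D by (simp add: lless_eq)
  qed
  have below_mid: "(\<Sum>u\<in>{u \<in> low. u \<sqsubseteq> v}. sign u) = - sign v" if v: "v \<in> mid" for v
  proof -
    have vc: "v \<in> carrier L" "x \<sqsubseteq> v" "v \<sqsubseteq> z" "rk v = Suc t" "x \<noteq> v"
      using v D by (auto simp: mid_def in_interval)
    have "rk u \<le> t \<longleftrightarrow> u \<noteq> v" if "u \<in> carrier L" "u \<sqsubseteq> v" for u
      using rank_strict_mono[of u v] that vc by (auto simp: lless_eq)
    then have "{u \<in> low. u \<sqsubseteq> v} = \<lbrace>x..v\<rbrace> - {v}"
      using vc D le_trans[of _ v z] by (auto simp: low_def in_interval)
    then show ?thesis using sign_sum_interval_minus_top[of x v] vc D by (simp add: lless_eq)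
  qed
  have below_low: "(\<Sum>u\<in>{u \<in> low. u \<sqsubseteq> v}. sign u) = (if v = x then sign v else 0)"
    if v: "v \<in> low" for v
  proof -
    have vc: "v \<in> carrier L" "x \<sqsubseteq> v" "v \<sqsubseteq> z" "rk v \<le> t"
      using v D by (auto simp: low_def in_interval)
    have "rk u \<le> t" if "u \<in> carrier L" "u \<sqsubseteq> v" for u
      using rank_mono[of u v] that vc by simp
    then have "{u \<in> low. u \<sqsubseteq> v} = \<lbrace>x..v\<rbrace>"
      using vc D le_trans[of _ v z] by (auto simp: low_def in_interval)
    then show ?thesis
      using sign_sum_interval[of x v] sign_sum_interval_refl[of x] vc D by (simp add: lless_eq)
  qed
  have sq: "sign v * sign v = 1" for v
    by (simp add: power_add[symmetric])
  have "(\<Sum>(u, v)\<in>{(u, v) \<in> crossing. x \<sqsubseteq> u \<and> v \<sqsubseteq> z}. sign u * sign v)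
      = (\<Sum>u\<in>low. sign u * (\<Sum>v\<in>{v \<in> high. u \<sqsubseteq> v}. sign v))"
    unfolding split sum_distrib_left by (rule sum.Sigma[symmetric]) (use fin in auto)
  also have "\<dots> = - (\<Sum>u\<in>low. \<Sum>v\<in>{v \<in> low \<union> mid. u \<sqsubseteq> v}. sign u * sign v)"
    by (simp add: above sum_negf sum_distrib_left)
  also have "\<dots> = - (\<Sum>v\<in>low \<union> mid. \<Sum>u\<in>{u \<in> low. u \<sqsubseteq> v}. sign u * sign v)"
    by (subst sum.swap_restrict) (use fin in auto)
  also have "\<dots> = - (\<Sum>v\<in>low \<union> mid. (\<Sum>u\<in>{u \<in> low. u \<sqsubseteq> v}. sign u) * sign v)"
    by (simp add: sum_distrib_right)
  also have "\<dots> = - ((\<Sum>v\<in>low. (\<Sum>u\<in>{u \<in> low. u \<sqsubseteq> v}. sign u) * sign v)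
      + (\<Sum>v\<in>mid. (\<Sum>u\<in>{u \<in> low. u \<sqsubseteq> v}. sign u) * sign v))"
    by (subst sum.union_disjoint) (use fin in \<open>auto simp: low_def mid_def\<close>)
  also have "(\<Sum>v\<in>low. (\<Sum>u\<in>{u \<in> low. u \<sqsubseteq> v}. sign u) * sign v) = (\<Sum>v\<in>low. if v = x then 1 else 0)"
  proof (rule sum.cong[OF HOL.refl])
    fix v assume "v \<in> low"
    from below_low[OF this]
    show "(\<Sum>u\<in>{u \<in> low. u \<sqsubseteq> v}. sign u) * sign v = (if v = x then 1 else 0)"
      by (simp only:) (simp add: sq)
  qed
  also have "\<dots> = 1"
    using fin D by (simp add: low_def in_interval)
  also have "(\<Sum>v\<in>mid. (\<Sum>u\<in>{u \<in> low. u \<sqsubseteq> v}. sign u) * sign v) = (\<Sum>v\<in>mid. - 1)"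
    by (rule sum.cong[OF HOL.refl]) (simp add: below_mid sq)
  finally show ?thesis by (simp add: mid_def)
qed

abbreviation E_sign :: "'a set \<Rightarrow> int" where "E_sign A \<equiv> (- 1) ^ poset_rank E A"

lemma E_sign_empty: "E_sign {} = (- 1) ^ poset_length L"
  by (simp add: E_rank E_memI)

lemma E_sign_singleton:
  assumes "y \<in> carrier L" "rk y = Suc t"
  shows "E_sign {y} = - ((- 1) ^ poset_length L)"
proof -
  have "poset_length L = Suc (poset_length L - 1)" using level_inside by simp
  then have "(- 1 :: int) ^ poset_length L = - ((- 1) ^ (poset_length L - 1))"
    by (metis power_Suc mult_minus1)
  then show ?thesis using assms by (simp add: E_rank E_memI)
qed

text \<open>The rank of a crossing interval has the parity of \<open>poset_length L + rk u + rk v\<close>, so the signs in \<open>E\<close>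
  factor through the endpoints.\<close>

lemma E_sign_interval:
  assumes "(u, v) \<in> crossing"
  shows "E_sign \<lbrace>u..v\<rbrace> = (- 1) ^ poset_length L * (sign u * sign v)"
proof -
  note D = crossingD[OF assms]
  have "poset_rank E \<lbrace>u..v\<rbrace> + rk v = poset_length L + rk u"
    using D rank_le_length[of v] assms by (simp add: E_rank E_memI corank_interval)
  then have "even (poset_rank E \<lbrace>u..v\<rbrace>) = even (poset_length L + rk u + rk v)"
    by presburger
  then have "E_sign \<lbrace>u..v\<rbrace> = (- 1) ^ (poset_length L + rk u + rk v)"
    by (simp only: minus_one_power_iff)
  then show ?thesis by (simp add: power_add)
qed

lemma interval_inj_on_crossing: "inj_on (\<lambda>(u, v). \<lbrace>u..v\<rbrace>) crossing"
proof (rule inj_onI, clarify)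
  fix u v x z assume "(u, v) \<in> crossing" "(x, z) \<in> crossing" "\<lbrace>u..v\<rbrace> = \<lbrace>x..z\<rbrace>"
  then show "u = x \<and> v = z" using interval_inject[of x z u v] crossingD by blast
qed

lemma E_sign_sum_intervals:
  assumes "P \<subseteq> crossing"
  shows "(\<Sum>C\<in>(\<lambda>(u, v). \<lbrace>u..v\<rbrace>) ` P. E_sign C)
    = (- 1) ^ poset_length L * (\<Sum>(u, v)\<in>P. sign u * sign v)"
proof -
  have "(\<Sum>C\<in>(\<lambda>(u, v). \<lbrace>u..v\<rbrace>) ` P. E_sign C) = (\<Sum>(u, v)\<in>P. E_sign \<lbrace>u..v\<rbrace>)"
    using inj_on_subset[OF interval_inj_on_crossing assms]
    by (simp add: sum.reindex case_prod_unfold)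
  also have "\<dots> = (\<Sum>(u, v)\<in>P. (- 1) ^ poset_length L * (sign u * sign v))"
    by (rule sum.cong[OF HOL.refl]) (use assms E_sign_interval in auto)
  finally show ?thesis by (simp add: sum_distrib_left case_prod_unfold)
qed

lemma E_sign_sum_point_empty:
  assumes "y \<in> carrier L" "rk y = Suc t"
  shows "(\<Sum>C\<in>{C \<in> carrier E. C \<subseteq> {y}}. E_sign C) = 0"
proof -
  have "{C \<in> carrier E. C \<subseteq> {y}} = {{}, {y}}"
    using E_memI(1,2) assms by (auto simp: subset_singleton_iff)
  then show ?thesis using assms by (simp add: E_sign_empty E_sign_singleton)
qed

lemma E_sign_sum_interval_empty:
  assumes xz: "(x, z) \<in> crossing"
  shows "(\<Sum>C\<in>{C \<in> carrier E. C \<subseteq> \<lbrace>x..z\<rbrace>}. E_sign C) = 0"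
proof -
  note D = crossingD[OF xz]
  define Y where "Y = {y \<in> \<lbrace>x..z\<rbrace>. rk y = Suc t}"
  define P where "P = {(u, v) \<in> crossing. x \<sqsubseteq> u \<and> v \<sqsubseteq> z}"
  let ?points = "(\<lambda>y. {y}) ` Y" and ?intervals = "(\<lambda>(u, v). \<lbrace>u..v\<rbrace>) ` P"
  have nested: "\<lbrace>u..v\<rbrace> \<subseteq> \<lbrace>x..z\<rbrace> \<longleftrightarrow> x \<sqsubseteq> u \<and> v \<sqsubseteq> z" if "(u, v) \<in> crossing" for u v
    using intervals_nested_iff[OF D(1,2) crossingD(1-3)[OF that]] .
  have "{C \<in> carrier E. C \<subseteq> \<lbrace>x..z\<rbrace>} = insert {} (?points \<union> ?intervals)"
  proof (intro equalityI subsetI)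
    fix C assume "C \<in> {C \<in> carrier E. C \<subseteq> \<lbrace>x..z\<rbrace>}"
    then have C: "C \<in> carrier E" "C \<subseteq> \<lbrace>x..z\<rbrace>" by auto
    then show "C \<in> insert {} (?points \<union> ?intervals)"
      using nested by (cases rule: E_cases) (auto simp: Y_def P_def)
  next
    fix C assume "C \<in> insert {} (?points \<union> ?intervals)"
    then show "C \<in> {C \<in> carrier E. C \<subseteq> \<lbrace>x..z\<rbrace>}"
      using nested E_memI by (auto simp: Y_def P_def in_interval[of _ x z])
  qed
  moreover have "{} \<notin> ?points \<union> ?intervals" "?points \<inter> ?intervals = {}"
    by (auto simp: P_def crossing_interval_neq)
  moreover have "P \<subseteq> carrier L \<times> carrier L" using crossingD(1,2) by (auto simp: P_def)
  then have "finite P" using finite_carrier finite_subset by blast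
  then have "finite ?points" "finite ?intervals" using finite_interval by (simp_all add: Y_def)
  ultimately have "(\<Sum>C\<in>{C \<in> carrier E. C \<subseteq> \<lbrace>x..z\<rbrace>}. E_sign C) =
      E_sign {} + ((\<Sum>C\<in>?points. E_sign C) + (\<Sum>C\<in>?intervals. E_sign C))"
    by (simp add: sum.union_disjoint)
  also have "(\<Sum>C\<in>?points. E_sign C) = (\<Sum>y\<in>Y. - ((- 1) ^ poset_length L))"
    by (subst sum.reindex) (auto simp: Y_def E_sign_singleton in_interval)
  also have "(\<Sum>C\<in>?intervals. E_sign C) = (- 1) ^ poset_length L * (int (card Y) - 1)"
    using E_sign_sum_intervals[of P] crossing_subintervals_sum[OF xz] by (auto simp: Y_def P_def)
  finally show ?thesis by (simp add: E_sign_empty algebra_simps)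
qed

text \<open>The two endpoints of a crossing interval through \<open>y\<close> vary independently over two intervals with the
  end \<open>y\<close> left out. The resulting product \<open>(- sign y) * (- sign y) = 1\<close> cancels the sign of \<open>{y}\<close>.\<close>

lemma E_sign_sum_interval_point:
  assumes xz: "(x, z) \<in> crossing" and y: "rk y = Suc t" "y \<in> \<lbrace>x..z\<rbrace>"
  shows "(\<Sum>C\<in>{C \<in> carrier E. {y} \<subseteq> C \<and> C \<subseteq> \<lbrace>x..z\<rbrace>}. E_sign C) = 0"
proof -
  note D = crossingD[OF xz]
  have yc: "y \<in> carrier L" "x \<sqsubseteq> y" "y \<sqsubseteq> z" using y by (auto simp: in_interval)
  have xyz: "x \<sqsubset> y" "y \<sqsubset> z" using yc y D by (auto simp: lless_eq)
  define P where "P = (\<lbrace>x..y\<rbrace> - {y}) \<times> (\<lbrace>y..z\<rbrace> - {y})"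
  let ?intervals = "(\<lambda>(u, v). \<lbrace>u..v\<rbrace>) ` P"
  have P: "(u, v) \<in> P \<longleftrightarrow> (u, v) \<in> crossing \<and> x \<sqsubseteq> u \<and> v \<sqsubseteq> z \<and> u \<sqsubseteq> y \<and> y \<sqsubseteq> v" for u v
    using y yc rank_strict_mono[of u y] rank_strict_mono[of y v] le_trans[of u y v]
    by (auto simp: P_def crossing_def in_interval lless_eq)
  have nested: "\<lbrace>u..v\<rbrace> \<subseteq> \<lbrace>x..z\<rbrace> \<longleftrightarrow> x \<sqsubseteq> u \<and> v \<sqsubseteq> z" if "(u, v) \<in> crossing" for u v
    using intervals_nested_iff[OF D(1,2) crossingD(1-3)[OF that]] .
  have "{C \<in> carrier E. {y} \<subseteq> C \<and> C \<subseteq> \<lbrace>x..z\<rbrace>} = insert {y} ?intervals"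
  proof (intro equalityI subsetI)
    fix C assume "C \<in> {C \<in> carrier E. {y} \<subseteq> C \<and> C \<subseteq> \<lbrace>x..z\<rbrace>}"
    then have C: "C \<in> carrier E" "y \<in> C" "C \<subseteq> \<lbrace>x..z\<rbrace>" by auto
    from C(1) show "C \<in> insert {y} ?intervals"
    proof (cases rule: E_cases)
      case (interval u v)
      then have "(u, v) \<in> P" using C nested by (auto simp: P in_interval[of y])
      then show ?thesis using interval(1) by force
    qed (use C in auto)
  next
    fix C assume "C \<in> insert {y} ?intervals"
    then consider "C = {y}" | u v where "C = \<lbrace>u..v\<rbrace>" "(u, v) \<in> P" by auto
    then show "C \<in> {C \<in> carrier E. {y} \<subseteq> C \<and> C \<subseteq> \<lbrace>x..z\<rbrace>}"
    proof cases
      case 1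
      then show ?thesis using y yc E_memI(2) by simp
    next
      case 2
      then have cr: "(u, v) \<in> crossing" and "y \<in> \<lbrace>u..v\<rbrace>" using yc by (auto simp: P in_interval)
      then show ?thesis using 2 nested[OF cr] E_memI(3)[OF cr] by (simp add: P)
    qed
  qed
  moreover have "{y} \<notin> ?intervals"
    by (auto simp: P crossing_interval_neq)
  moreover have "finite ?intervals" by (simp add: P_def finite_interval)
  ultimately have "(\<Sum>C\<in>{C \<in> carrier E. {y} \<subseteq> C \<and> C \<subseteq> \<lbrace>x..z\<rbrace>}. E_sign C) =
      E_sign {y} + (\<Sum>C\<in>?intervals. E_sign C)" by simp
  also have "(\<Sum>C\<in>?intervals. E_sign C) = (- 1) ^ poset_length L * ((- sign y) * (- sign y))"
  proof -
    have "P \<subseteq> crossing" using P by auto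
    then show ?thesis
      using sign_sum_interval_minus_top[of x y] sign_sum_interval_minus_bot[of y z] yc D xyz
      by (simp add: E_sign_sum_intervals P_def sign_sum_product)
  qed
  finally show ?thesis using y yc by (simp add: E_sign_singleton power_add[symmetric])
qed

text \<open>The endpoints vary independently, one over the interval from \<open>x\<close> to \<open>u\<close> and the other over the one
  from \<open>v\<close> to \<open>z\<close>. At least one of these is nontrivial, so its factor vanishes.\<close>

lemma E_sign_sum_interval_interval:
  assumes xz: "(x, z) \<in> crossing" and uv: "(u, v) \<in> crossing" and sub: "\<lbrace>u..v\<rbrace> \<subset> \<lbrace>x..z\<rbrace>"
  shows "(\<Sum>C\<in>{C \<in> carrier E. \<lbrace>u..v\<rbrace> \<subseteq> C \<and> C \<subseteq> \<lbrace>x..z\<rbrace>}. E_sign C) = 0"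
proof -
  note D = crossingD[OF xz] and D' = crossingD[OF uv]
  have n: "x \<sqsubseteq> u" "v \<sqsubseteq> z" "u \<noteq> x \<or> v \<noteq> z"
    using sub intervals_strictly_nested_iff[OF D(1,2) D'(1-3) D(3)] by auto
  define P where "P = \<lbrace>x..u\<rbrace> \<times> \<lbrace>v..z\<rbrace>"
  have P: "(a, b) \<in> P \<longleftrightarrow> (a, b) \<in> crossing \<and> x \<sqsubseteq> a \<and> a \<sqsubseteq> u \<and> v \<sqsubseteq> b \<and> b \<sqsubseteq> z" for a b
    using crossing_interval_mono[OF uv, of a b] crossingD[of a b] by (auto simp: P_def in_interval)
  have "{C \<in> carrier E. \<lbrace>u..v\<rbrace> \<subseteq> C \<and> C \<subseteq> \<lbrace>x..z\<rbrace>} = (\<lambda>(u, v). \<lbrace>u..v\<rbrace>) ` P"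
  proof (intro equalityI subsetI)
    fix C assume "C \<in> {C \<in> carrier E. \<lbrace>u..v\<rbrace> \<subseteq> C \<and> C \<subseteq> \<lbrace>x..z\<rbrace>}"
    then have C: "C \<in> carrier E" "\<lbrace>u..v\<rbrace> \<subseteq> C" "C \<subseteq> \<lbrace>x..z\<rbrace>" by auto
    from C(1) show "C \<in> (\<lambda>(u, v). \<lbrace>u..v\<rbrace>) ` P"
    proof (cases rule: E_cases)
      case (interval a b)
      note ab = crossingD[OF interval(2)]
      have "(a, b) \<in> P"
        using C interval intervals_nested_iff[OF D(1,2) ab(1-3)]
          intervals_nested_iff[OF ab(1,2) D'(1-3)] by (simp add: P)
      then show ?thesis using interval(1) by force
    qed (use C D' crossing_interval_not_subset_singleton[OF uv] in auto)
  next
    fix C assume "C \<in> (\<lambda>(u, v). \<lbrace>u..v\<rbrace>) ` P"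
    then obtain a b where ab: "C = \<lbrace>a..b\<rbrace>" "(a, b) \<in> P" by auto
    then have cr: "(a, b) \<in> crossing" by (simp add: P)
    note ab' = crossingD[OF cr]
    show "C \<in> {C \<in> carrier E. \<lbrace>u..v\<rbrace> \<subseteq> C \<and> C \<subseteq> \<lbrace>x..z\<rbrace>}"
      using ab E_memI(3)[OF cr] intervals_nested_iff[OF D(1,2) ab'(1-3)]
        intervals_nested_iff[OF ab'(1,2) D'(1-3)] by (simp add: P)
  qed
  moreover have "P \<subseteq> crossing" using P by auto
  ultimately have "(\<Sum>C\<in>{C \<in> carrier E. \<lbrace>u..v\<rbrace> \<subseteq> C \<and> C \<subseteq> \<lbrace>x..z\<rbrace>}. E_sign C) =
      (- 1) ^ poset_length L * ((\<Sum>a\<in>\<lbrace>x..u\<rbrace>. sign a) * (\<Sum>b\<in>\<lbrace>v..z\<rbrace>. sign b))"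
    using E_sign_sum_intervals[of P] by (simp add: P_def sign_sum_product)
  moreover have "(\<Sum>a\<in>\<lbrace>x..u\<rbrace>. sign a) = 0 \<or> (\<Sum>b\<in>\<lbrace>v..z\<rbrace>. sign b) = 0"
    using sign_sum_interval[of x u] sign_sum_interval[of v z] n D D' by (auto simp: lless_eq)
  ultimately show ?thesis by auto
qed

theorem E_eulerian: "eulerian_poset E"
  unfolding eulerian_poset_iff_signed_sum[OF E_graded]
proof (intro ballI impI)
  fix A B assume A: "A \<in> carrier E" and B: "B \<in> carrier E" and "A \<sqsubset>\<^bsub>E\<^esub> B"
  then have BA: "B \<subset> A" by (simp add: lless_E)
  have "\<lbrace>A..B\<rbrace>\<^bsub>E\<^esub> = {C \<in> carrier E. B \<subseteq> C \<and> C \<subseteq> A}"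
    by (auto simp: at_least_at_most_def le_E)
  moreover have "(\<Sum>C\<in>{C \<in> carrier E. B \<subseteq> C \<and> C \<subseteq> A}. E_sign C) = 0"
    using A
  proof (cases rule: E_cases)
    case empty
    then show ?thesis using BA by simp
  next
    case (point y)
    then have "B = {}" using BA by auto
    then show ?thesis using E_sign_sum_point_empty point by simp
  next
    case (interval x z)
    note A_eq = interval(1) and xz = interval(2)
    from B show ?thesis
    proof (cases rule: E_cases)
      case empty
      then show ?thesis using E_sign_sum_interval_empty[OF xz] A_eq by simp
    next
      case (point y)
      then have "y \<in> \<lbrace>x..z\<rbrace>" using A_eq BA by auto
      then show ?thesis using E_sign_sum_interval_point[OF xz point(3)] point(1) A_eq by simp
    next
      case (interval u v)
      then show ?thesis using E_sign_sum_interval_interval[OF xz] A_eq BA by simp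
    qed
  qed
  ultimately show "(\<Sum>C\<in>\<lbrace>A..B\<rbrace>\<^bsub>E\<^esub>. E_sign C) = 0" by simp
qed

end

theorem theorem1p4:
  fixes L :: "'a gorder" and d t :: nat
  assumes "eulerian_poset L"
    and "poset_length L = d + 1"
    and "int t \<le> int d - 1"
  shows "eulerian_poset (E_poset t L) \<and> poset_length (E_poset t L) = d + 1"
proof -
  interpret eulerian_poset_level L t
    using assms by unfold_locales (auto simp: eulerian_poset_def)
  show ?thesis using E_eulerian E_length assms(2) by simp
qed

end
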